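(* Suppose the input $x\in[n]^{2n-1}$ has entries sampled independently and uniformly from $[n]$. Then $ED^{\boxplus n}$ can be solved (with zero error) by an algorithm running in $O(n)$ expected time and using $O(\log n)$ bits of space.
   Context: $ED(a)=1$ if all symbols of the string $a$ are distinct and $0$ otherwise. $ED^{\boxplus n}(x)=(ED(x_i\ldots x_{i+n-1}))_{i=1}^n$ for $x=x_1\ldots x_{2n-1}$. Space excludes the read-only input and write-only output. *)

theory Defs
  imports
    "HOL-Probability.Probability"
    "HOL-Library.Landau_Symbols"
    "HOL-Library.Log_Nat"
begin

definition ED :: "'a list \<Rightarrow> nat" where
  "ED a = (if distinct a then 1 else 0)"

text \<open>The operator taking \<open>f\<close> to its sliding-window version; positions in \<open>x\<close> are counted
  from 0, so window \<open>i\<close> is the factor of length \<open>n\<close> starting at position \<open>i\<close>.\<close>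

definition sliding :: "('a list \<Rightarrow> 'b) \<Rightarrow> nat \<Rightarrow> 'a list \<Rightarrow> 'b list" where
  "sliding f n x = map (\<lambda>i. f (take n (drop i x))) [0..<n]"

definition inputs :: "nat \<Rightarrow> nat list set" where
  "inputs n = {x. length x = 2 * n - 1 \<and> set x \<subseteq> {1..n}}"

definition input_distr :: "nat \<Rightarrow> nat list pmf" where
  "input_distr n = replicate_pmf (2 * n - 1) (pmf_of_set {1..n})"

text \<open>The model of computation is a random access machine with a read-only random-access input and
  an append-only output that the machine cannot read. A program is a fixed finite list of
  instructions, used for all input lengths. The working memory consists of cells holding natural
  numbers, all initially 0. Every instruction takes unit time; since the space measure below counts
  the bits of all cell contents, a machine using \<open>O(log n)\<close> bits of space only ever operates on
  words of \<open>O(log n)\<close> bits.\<close>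

datatype instr =
    Const nat nat
  | Copy nat nat
  | Add nat nat nat
  | Sub nat nat nat
  | Mul nat nat nat
  | Div nat nat nat
  | Mod nat nat nat
  | Load nat nat
  | Store nat nat
  | Length nat
  | Read nat nat
  | Write nat
  | Jump nat
  | Jump_Eq nat nat nat
  | Jump_Less nat nat nat

record config =
  pc :: nat
  mem :: "nat \<Rightarrow> nat"
  out :: "nat list"

definition init_config :: config where
  "init_config = \<lparr>pc = 0, mem = (\<lambda>_. 0), out = []\<rparr>"

definition assign :: "nat \<Rightarrow> nat \<Rightarrow> config \<Rightarrow> config" where
  "assign r v c = c\<lparr>pc := Suc (pc c), mem := (mem c)(r := v)\<rparr>"

text \<open>Subtraction is truncated; reading the input outside its bounds yields 0.\<close>

fun exec :: "nat list \<Rightarrow> instr \<Rightarrow> config \<Rightarrow> config" where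
  "exec x (Const r k) c = assign r k c"
| "exec x (Copy r i) c = assign r (mem c i) c"
| "exec x (Add r i j) c = assign r (mem c i + mem c j) c"
| "exec x (Sub r i j) c = assign r (mem c i - mem c j) c"
| "exec x (Mul r i j) c = assign r (mem c i * mem c j) c"
| "exec x (Div r i j) c = assign r (mem c i div mem c j) c"
| "exec x (Mod r i j) c = assign r (mem c i mod mem c j) c"
| "exec x (Load r i) c = assign r (mem c (mem c i)) c"
| "exec x (Store r i) c = assign (mem c r) (mem c i) c"
| "exec x (Length r) c = assign r (length x) c"
| "exec x (Read r i) c = assign r (if mem c i < length x then x ! mem c i else 0) c"
| "exec x (Write i) c = c\<lparr>pc := Suc (pc c), out := out c @ [mem c i]\<rparr>"
| "exec x (Jump l) c = c\<lparr>pc := l\<rparr>"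
| "exec x (Jump_Eq i j l) c = c\<lparr>pc := (if mem c i = mem c j then l else Suc (pc c))\<rparr>"
| "exec x (Jump_Less i j l) c = c\<lparr>pc := (if mem c i < mem c j then l else Suc (pc c))\<rparr>"

definition halted :: "instr list \<Rightarrow> config \<Rightarrow> bool" where
  "halted P c \<longleftrightarrow> length P \<le> pc c"

definition step :: "instr list \<Rightarrow> nat list \<Rightarrow> config \<Rightarrow> config" where
  "step P x c = (if halted P c then c else exec x (P ! pc c) c)"

definition run :: "instr list \<Rightarrow> nat list \<Rightarrow> nat \<Rightarrow> config" where
  "run P x t = (step P x ^^ t) init_config"

definition ram_halts :: "instr list \<Rightarrow> nat list \<Rightarrow> bool" where
  "ram_halts P x \<longleftrightarrow> (\<exists>t. halted P (run P x t))"

definition ram_time :: "instr list \<Rightarrow> nat list \<Rightarrow> nat" where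
  "ram_time P x = (LEAST t. halted P (run P x t))"

definition ram_output :: "instr list \<Rightarrow> nat list \<Rightarrow> nat list" where
  "ram_output P x = out (run P x (ram_time P x))"

text \<open>The logarithmic space measure: \<open>floorlog 2 k\<close> is the number of binary digits of \<open>k\<close>, and a
  configuration is charged for its program counter and, for every cell not holding the initial value
  0, for both the address and the content. Input and output are not charged.\<close>

definition config_space :: "config \<Rightarrow> nat" where
  "config_space c = floorlog 2 (pc c) +
     (\<Sum>a \<in> {a. mem c a \<noteq> 0}. floorlog 2 a + floorlog 2 (mem c a))"

definition ram_space :: "instr list \<Rightarrow> nat list \<Rightarrow> nat" where
  "ram_space P x = Max ((\<lambda>t. config_space (run P x t)) ` {..ram_time P x})"

end

theory Submission imports Defs "HOL-Real_Asymp.Real_Asymp" begin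

text \<open>Let \<open>h = n div 2\<close>. The consecutive blocks \<open>[n - 1 - h, n - 1)\<close> and \<open>[n - 1, n - 1 + h)\<close>
  together have length at most \<open>n\<close>, so every window contains one of them. If both contain a
  repeated letter, the output consists of zeros only; otherwise the machine falls back to testing
  every window on its own, in time \<open>O(n^3)\<close>. A block is tested by comparing each letter with all
  its predecessors, stopping at the first repetition; letter \<open>l\<close> is examined only if the \<open>l\<close>
  letters before it are distinct, which happens with probability \<open>q l\<close>, and costs \<open>O(l + 1)\<close>. As
  \<open>q (l + 1) = (1 - l / n) q l\<close>, the sum of the \<open>l q l = n (q l - q (l + 1))\<close> telescopes to at most
  \<open>n\<close>, so the block tests take linear expected time. The fallback has probability at most
  \<open>2 q h\<close>, which is exponentially small.\<close>

subsection \<open>Bounded reachability\<close>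

text \<open>An upper bound on the number of steps, not the exact number: branches of different
  length can then share one bound.\<close>

definition reach :: "instr list \<Rightarrow> nat list \<Rightarrow> nat \<Rightarrow> config \<Rightarrow> config \<Rightarrow> bool" where
  "reach P x k c c' \<longleftrightarrow> (\<exists>t\<le>k. (step P x ^^ t) c = c')"

abbreviation Cfg :: "nat \<Rightarrow> (nat \<Rightarrow> nat) \<Rightarrow> nat list \<Rightarrow> config" where
  "Cfg i m w \<equiv> \<lparr>pc = i, mem = m, out = w\<rparr>"

lemma reach_refl: "reach P x k c c"
  unfolding reach_def by (rule exI[of _ 0]) auto

text \<open>Applied backwards, it executes one instruction. Step counts are written as nested
  \<open>Suc\<close> so that repeated introduction runs straight-line code symbolically.\<close>

lemma reach_step: "reach P x k (step P x c) c' \<Longrightarrow> reach P x (Suc k) c c'"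
  unfolding reach_def
  by (metis Suc_le_mono comp_apply funpow_Suc_right)

lemma reach_trans: "reach P x k c c' \<Longrightarrow> reach P x l c' c'' \<Longrightarrow> reach P x (k + l) c c''"
  unfolding reach_def
proof (elim exE conjE)
  fix s t assume *: "s \<le> k" "(step P x ^^ s) c = c'" "t \<le> l" "(step P x ^^ t) c' = c''"
  then have "(step P x ^^ (t + s)) c = c''"
    by (simp add: funpow_add)
  then show "\<exists>t\<le>k + l. (step P x ^^ t) c = c''"
    using * by (intro exI[of _ "t + s"]) auto
qed

lemma reach_mono: "reach P x k c c' \<Longrightarrow> k \<le> l \<Longrightarrow> reach P x l c c'"
  unfolding reach_def using le_trans by blast

subsection \<open>Testing one block\<close>

definition code_at :: "instr list \<Rightarrow> nat \<Rightarrow> instr list \<Rightarrow> bool" where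
  "code_at P p Q \<longleftrightarrow> (\<forall>i<length Q. p + i < length P \<and> P ! (p + i) = Q ! i)"

text \<open>Tests the positions from the content of register 3 up to, excluding, that of register 4;
  registers 5 and 6 hold the two positions being compared, 7 and 8 the letters read there. Jumps
  to \<open>d\<close> when a repetition is found and to \<open>f\<close> otherwise. Register 0 must hold 1. The address
  \<open>p\<close> is the position of the code in the whole program.\<close>

definition scan_code :: "nat \<Rightarrow> nat \<Rightarrow> nat \<Rightarrow> instr list" where
  "scan_code p d f =
    [Copy 5 3,
     Jump_Less 5 4 (p + 3),
     Jump f,
     Copy 6 3,
     Jump_Less 6 5 (p + 7),
     Add 5 5 0,
     Jump (p + 1),
     Read 7 5,
     Read 8 6,
     Jump_Eq 7 8 d,
     Add 6 6 0,
     Jump (p + 4)]"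

text \<open>Registers 5 to 8 are the scratch registers of a scan. The block bounds in 3 and 4
  survive it, so the window loop can advance them.\<close>

definition frame :: "(nat \<Rightarrow> nat) \<Rightarrow> (nat \<Rightarrow> nat) \<Rightarrow> bool" where
  "frame m m' \<longleftrightarrow> (\<forall>a. a \<notin> {5, 6, 7, 8} \<longrightarrow> m' a = m a)"

lemma frame_trans: "frame m m' \<Longrightarrow> frame m' m'' \<Longrightarrow> frame m m''"
  by (simp add: frame_def)

text \<open>Letter \<open>l\<close> costs at most \<open>2 + (6 * l + 3)\<close> steps and is
  charged only if no repetition precedes it; the final 3 is the initial copy plus the two
  instructions that leave at the end of the block. In this form the expectation is a sum of
  distinctness probabilities.\<close>

definition scan_time :: "nat list \<Rightarrow> nat \<Rightarrow> nat \<Rightarrow> nat" where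
  "scan_time x b h = (\<Sum>l<h. if distinct (take l (drop b x)) then 6 * (l + 1) else 0) + 3"

text \<open>Turns distinctness of prefixes into the question that the inner loop decides: does a
  letter occur at an earlier position of the block?\<close>

lemma distinct_take_Suc_drop:
  assumes "b + l < length x"
  shows "distinct (take (Suc l) (drop b x)) \<longleftrightarrow>
    distinct (take l (drop b x)) \<and> x ! (b + l) \<notin> (!) x ` {b..<b + l}"
proof -
  have "set (take l (drop b x)) = (!) x ` {b..<b + l}"
  proof -
    have "set (take l (drop b x)) = (\<lambda>i. x ! (b + i)) ` {..<l}"
      using assms by (force simp: set_conv_nth image_iff)
    also have "\<dots> = (!) x ` ((+) b ` {0..<l})"
      by (simp only: image_image atLeast0LessThan)
    also have "(+) b ` {0..<l} = {b..<b + l}"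
      by (simp add: add.commute)
    finally show ?thesis .
  qed
  then show ?thesis
    using assms by (auto simp: take_Suc_conv_app_nth)
qed

context
  fixes P :: "instr list" and x :: "nat list" and p d f :: nat
  assumes code: "code_at P p (scan_code p d f)"
begin

lemma scan_code_nth: "i < 12 \<Longrightarrow> p + i < length P \<and> P ! (p + i) = scan_code p d f ! i"
  using code by (simp add: code_at_def scan_code_def)

lemma scan_code_steps:
  "step P x (Cfg p m w) = Cfg (Suc p) (m(5 := m 3)) w"
  "step P x (Cfg (Suc p) m w) = Cfg (if m 5 < m 4 then p + 3 else Suc (Suc p)) m w"
  "step P x (Cfg (Suc (Suc p)) m w) = Cfg f m w"
  "step P x (Cfg (p + 3) m w) = Cfg (p + 4) (m(6 := m 3)) w"
  "step P x (Cfg (p + 4) m w) = Cfg (if m 6 < m 5 then p + 7 else p + 5) m w"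
  "step P x (Cfg (p + 5) m w) = Cfg (p + 6) (m(5 := m 5 + m 0)) w"
  "step P x (Cfg (p + 6) m w) = Cfg (Suc p) m w"
  "step P x (Cfg (p + 7) m w) = Cfg (p + 8) (m(7 := if m 5 < length x then x ! m 5 else 0)) w"
  "step P x (Cfg (p + 8) m w) = Cfg (p + 9) (m(8 := if m 6 < length x then x ! m 6 else 0)) w"
  "step P x (Cfg (p + 9) m w) = Cfg (if m 7 = m 8 then d else p + 10) m w"
  "step P x (Cfg (p + 10) m w) = Cfg (p + 11) (m(6 := m 6 + m 0)) w"
  "step P x (Cfg (p + 11) m w) = Cfg (p + 4) m w"
  using scan_code_nth[of 0] scan_code_nth[of 1] scan_code_nth[of 2] scan_code_nth[of 3]
    scan_code_nth[of 4] scan_code_nth[of 5] scan_code_nth[of 6] scan_code_nth[of 7]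
    scan_code_nth[of 8] scan_code_nth[of 9] scan_code_nth[of 10] scan_code_nth[of 11]
  by (simp_all add: step_def halted_def assign_def scan_code_def)

text \<open>Six instructions per unequal predecessor and three to leave the loop. Without a match,
  register 5 has moved on to the next letter, which the outer loop relies on.\<close>

lemma scan_inner:
  assumes "m 0 = 1" "m 5 = j" "m 6 = k" "k \<le> j" "j < length x"
  shows "\<exists>m'. frame m m' \<and> (x ! j \<notin> (!) x ` {k..<j} \<longrightarrow> m' 5 = Suc j) \<and>
    reach P x (6 * (j - k) + 3) (Cfg (p + 4) m w)
      (Cfg (if x ! j \<in> (!) x ` {k..<j} then d else Suc p) m' w)"
  using assms
proof (induction "j - k" arbitrary: k m)
  case 0
  have "reach P x (Suc (Suc (Suc 0))) (Cfg (p + 4) m w) (Cfg (Suc p) (m(5 := Suc j)) w)"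
    using 0 by (intro reach_step) (simp add: scan_code_steps reach_refl)
  moreover have "frame m (m(5 := Suc j))" "{k..<j} = {}" "6 * (j - k) + 3 = Suc (Suc (Suc 0))"
    using 0 by (auto simp: frame_def)
  ultimately show ?case
    by (metis fun_upd_same image_empty empty_iff)
next
  case (Suc r)
  then have kj: "k < j" by simp
  have range: "{k..<j} = insert k {Suc k..<j}"
    using kj by auto
  let ?m = "m(7 := x ! j, 8 := x ! k)"
  have 1: "reach P x (Suc (Suc (Suc (Suc 0)))) (Cfg (p + 4) m w)
      (Cfg (if x ! j = x ! k then d else p + 10) ?m w)"
    using Suc.prems kj by (intro reach_step) (simp add: scan_code_steps reach_refl)
  show ?case
  proof (cases "x ! j = x ! k")
    case True
    have "reach P x (6 * (j - k) + 3) (Cfg (p + 4) m w) (Cfg d ?m w)"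
      by (rule reach_mono[of _ _ "Suc (Suc (Suc (Suc 0)))"]) (use kj True 1 in simp_all)
    moreover have "frame m ?m" "x ! j \<in> (!) x ` {k..<j}"
      using True range by (simp_all add: frame_def)
    ultimately show ?thesis
      by (intro exI[of _ ?m]) (simp only: simp_thms if_True not_True_eq_False)
  next
    case False
    let ?m' = "?m(6 := Suc k)"
    have "reach P x (Suc (Suc 0)) (Cfg (p + 10) ?m w) (Cfg (p + 4) ?m' w)"
      using Suc.prems by (intro reach_step) (simp add: scan_code_steps reach_refl)
    with 1 False have 2: "reach P x (Suc (Suc (Suc (Suc 0))) + Suc (Suc 0)) (Cfg (p + 4) m w) (Cfg (p + 4) ?m' w)"
      by (simp only: if_False reach_trans)
    obtain m' where m': "frame ?m' m'" "x ! j \<notin> (!) x ` {Suc k..<j} \<longrightarrow> m' 5 = Suc j"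
      "reach P x (6 * (j - Suc k) + 3) (Cfg (p + 4) ?m' w)
        (Cfg (if x ! j \<in> (!) x ` {Suc k..<j} then d else Suc p) m' w)"
    proof -
      have "r = j - Suc k" "?m' 0 = 1" "?m' 5 = j" "?m' 6 = Suc k" "Suc k \<le> j"
        using Suc.hyps(2) Suc.prems kj by simp_all
      then show ?thesis
        using Suc.hyps(1)[of "Suc k" ?m'] Suc.prems(5) that by blast
    qed
    have "frame m m'"
      using m'(1) by (auto simp: frame_def)
    moreover have "reach P x (6 * (j - k) + 3) (Cfg (p + 4) m w)
        (Cfg (if x ! j \<in> (!) x ` {Suc k..<j} then d else Suc p) m' w)"
      by (rule reach_mono[OF reach_trans[OF 2 m'(3)]]) (use kj in simp)
    moreover have "x ! j \<in> (!) x ` {k..<j} \<longleftrightarrow> x ! j \<in> (!) x ` {Suc k..<j}"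
      using False range by simp
    ultimately show ?thesis
      using m'(2) by metis
  qed
qed

text \<open>Loop invariant: the first \<open>l\<close> letters of the block are distinct and
  register 5 points at the next one.\<close>

lemma scan_outer:
  assumes "m 0 = 1" "m 3 = b" "m 4 = b + h" "m 5 = b + l" "b + h \<le> length x" "l \<le> h"
    and "distinct (take l (drop b x))"
  shows "\<exists>m'. frame m m' \<and>
    reach P x ((\<Sum>i=l..<h. if distinct (take i (drop b x)) then 6 * (i + 1) else 0) + 2)
      (Cfg (Suc p) m w) (Cfg (if distinct (take h (drop b x)) then f else d) m' w)"
  using assms
proof (induction "h - l" arbitrary: l m)
  case 0
  have "reach P x (Suc (Suc 0)) (Cfg (Suc p) m w) (Cfg f m w)"
    using 0 by (intro reach_step) (simp add: scan_code_steps reach_refl)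
  then show ?case
    using 0 by (intro exI[of _ m]) (auto simp: frame_def numeral_2_eq_2)
next
  case (Suc r)
  then have lh: "l < h" by simp
  let ?S = "\<lambda>l. \<Sum>i=l..<h. if distinct (take i (drop b x)) then 6 * (i + 1) else 0"
  have S: "?S l = 6 * (l + 1) + ?S (Suc l)"
    using lh Suc.prems by (simp add: sum.atLeast_Suc_lessThan)
  let ?m = "m(6 := b)"
  let ?dup = "x ! (b + l) \<in> (!) x ` {b..<b + l}"
  have "reach P x (Suc (Suc 0)) (Cfg (Suc p) m w) (Cfg (p + 4) ?m w)"
    using Suc.prems lh by (intro reach_step) (simp add: scan_code_steps reach_refl)
  moreover obtain m1 where m1: "frame ?m m1" "\<not> ?dup \<longrightarrow> m1 5 = Suc (b + l)"
    "reach P x (6 * l + 3) (Cfg (p + 4) ?m w) (Cfg (if ?dup then d else Suc p) m1 w)"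
    using scan_inner[of ?m "b + l" b w] Suc.prems lh by auto
  ultimately have 1: "reach P x (Suc (Suc 0) + (6 * l + 3)) (Cfg (Suc p) m w)
      (Cfg (if ?dup then d else Suc p) m1 w)"
    by (metis reach_trans)
  have fr: "frame m m1"
    using m1(1) by (auto simp: frame_def)
  have dist: "distinct (take (Suc l) (drop b x)) \<longleftrightarrow> \<not> ?dup"
    using distinct_take_Suc_drop[of b l x] Suc.prems lh by simp
  show ?case
  proof (cases ?dup)
    case True
    then have ndist: "\<not> distinct (take h (drop b x))"
      using dist distinct_take[of "take h (drop b x)" "Suc l"] lh by (auto simp: min_def)
    \<comment> \<open>The iteration takes at most \<open>6 * l + 5\<close> steps, which the summand
      \<open>6 * (l + 1)\<close> split off in \<open>S\<close> covers.\<close>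
    have "reach P x (?S l + 2) (Cfg (Suc p) m w) (Cfg d m1 w)"
      by (rule reach_mono[of _ _ "Suc (Suc 0) + (6 * l + 3)"]) (use 1 True S in simp_all)
    then show ?thesis
      using ndist fr by (intro exI[of _ m1]) simp
  next
    case False
    obtain m' where m': "frame m1 m'" "reach P x (?S (Suc l) + 2)
      (Cfg (Suc p) m1 w) (Cfg (if distinct (take h (drop b x)) then f else d) m' w)"
    proof -
      have "r = h - Suc l" "m1 0 = 1" "m1 3 = b" "m1 4 = b + h" "m1 5 = b + Suc l" "Suc l \<le> h"
        "distinct (take (Suc l) (drop b x))"
        using Suc.hyps(2) Suc.prems lh dist False fr m1(2) by (simp_all add: frame_def)
      then show ?thesis
        using Suc.hyps(1)[of "Suc l" m1] Suc.prems(5) that by blast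
    qed
    have "reach P x (?S l + 2) (Cfg (Suc p) m w)
        (Cfg (if distinct (take h (drop b x)) then f else d) m' w)"
      by (rule reach_mono[OF reach_trans[OF _ m'(2)]])
        (use 1 False S in auto)
    then show ?thesis
      using frame_trans[OF fr m'(1)] by blast
  qed
qed

text \<open>The first instruction points register 5 at the start of the block, where the invariant
  of the outer loop holds for the empty prefix.\<close>

lemma scan_reach:
  assumes "m 0 = 1" "m 3 = b" "m 4 = b + h" "b + h \<le> length x"
  obtains m' where "frame m m'"
    "reach P x (scan_time x b h) (Cfg p m w)
      (Cfg (if distinct (take h (drop b x)) then f else d) m' w)"
proof -
  let ?m = "m(5 := b)"
  obtain m' where m': "frame ?m m'"
    "reach P x ((\<Sum>i=0..<h. if distinct (take i (drop b x)) then 6 * (i + 1) else 0) + 2)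
      (Cfg (Suc p) ?m w) (Cfg (if distinct (take h (drop b x)) then f else d) m' w)"
    using scan_outer[of ?m b h 0 w] assms by auto
  have "reach P x (scan_time x b h) (Cfg p m w)
      (Cfg (if distinct (take h (drop b x)) then f else d) m' w)"
    using m'(2) assms reach_step[of P x _ "Cfg p m w"]
    by (simp add: scan_time_def scan_code_steps(1) atLeast0LessThan eval_nat_numeral)
  moreover have "frame m m'"
    using m'(1) by (auto simp: frame_def)
  ultimately show ?thesis by (rule that[rotated])
qed

end

subsection \<open>The program\<close>

lemma step_funpow_halted:
  assumes "halted P c"
  shows "(step P x ^^ t) c = c"
  using assms by (induction t) (auto simp: step_def)

text \<open>Halted configurations are fixed points of \<open>step\<close>, so a halted configuration
  reached at any time agrees with the one at the least halting time.\<close>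

lemma reach_halted:
  assumes "reach P x k init_config c" "halted P c"
  shows "ram_halts P x" "ram_time P x \<le> k" "ram_output P x = out c"
proof -
  obtain t where t: "t \<le> k" "run P x t = c"
    using assms by (auto simp: reach_def run_def)
  then have ht: "halted P (run P x t)"
    using assms by simp
  then show "ram_halts P x"
    by (auto simp: ram_halts_def)
  have le: "ram_time P x \<le> t"
    unfolding ram_time_def using ht by (rule Least_le)
  with t show "ram_time P x \<le> k"
    by simp
  have h: "halted P (run P x (ram_time P x))"
    unfolding ram_time_def using ht by (rule LeastI)
  have "run P x t = (step P x ^^ (t - ram_time P x)) (run P x (ram_time P x))"
    using le by (simp add: run_def flip: funpow_add comp_apply[of "step P x ^^ _"])
  then show "ram_output P x = out c"
    using step_funpow_halted[OF h] t by (simp add: ram_output_def)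
qed

text \<open>Register 0 holds 1, register 1 holds \<open>n div 2\<close>, register 2 holds \<open>n\<close> and register 9 holds
  \<open>n - 1\<close>; register 10 is never written and serves as the constant 0. Address 37 starts the loop
  that writes \<open>n\<close> zeros, address 43 the test of all windows. Sums of two arbitrary registers are
  avoided for the sake of the space bound, whence the detour at address 22.\<close>

definition ed_prog :: "instr list" where
  "ed_prog =
    [Const 0 1, Length 2, Add 2 2 0, Const 1 2, Div 2 2 1, Div 1 2 1,
     Sub 9 2 0, Sub 3 9 1, Copy 4 9] @
    scan_code 9 21 43 @
    [Copy 3 9, Length 4, Sub 5 2 1, Sub 4 4 5] @
    scan_code 25 37 43 @
    [Const 3 0, Jump_Less 3 2 40, Jump 63, Write 10, Add 3 3 0, Jump 38] @
    [Const 3 0, Copy 4 2] @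
    scan_code 45 57 59 @
    [Write 10, Jump 60, Write 0, Add 3 3 0, Add 4 4 0, Jump_Less 3 2 45]"

lemma length_SP: "length ed_prog = 63"
  by (simp add: ed_prog_def scan_code_def)

lemma ed_prog_code_at:
  "code_at ed_prog 9 (scan_code 9 21 43)"
  "code_at ed_prog 25 (scan_code 25 37 43)"
  "code_at ed_prog 45 (scan_code 45 57 59)"
  unfolding code_at_def ed_prog_def
  by (auto simp: scan_code_def nth_append nth_Cons split: nat.splits)

lemma ed_prog_steps:
  "step ed_prog x (Cfg 0 m w) = Cfg (Suc 0) (m(0 := Suc 0)) w"
  "step ed_prog x (Cfg (Suc 0) m w) = Cfg 2 (m(2 := length x)) w"
  "step ed_prog x (Cfg 2 m w) = Cfg 3 (m(2 := m 2 + m 0)) w"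
  "step ed_prog x (Cfg 3 m w) = Cfg 4 (m(Suc 0 := 2)) w"
  "step ed_prog x (Cfg 4 m w) = Cfg 5 (m(2 := m 2 div m (Suc 0))) w"
  "step ed_prog x (Cfg 5 m w) = Cfg 6 (m(Suc 0 := m 2 div m (Suc 0))) w"
  "step ed_prog x (Cfg 6 m w) = Cfg 7 (m(9 := m 2 - m 0)) w"
  "step ed_prog x (Cfg 7 m w) = Cfg 8 (m(3 := m 9 - m (Suc 0))) w"
  "step ed_prog x (Cfg 8 m w) = Cfg 9 (m(4 := m 9)) w"
  "step ed_prog x (Cfg 21 m w) = Cfg 22 (m(3 := m 9)) w"
  "step ed_prog x (Cfg 22 m w) = Cfg 23 (m(4 := length x)) w"
  "step ed_prog x (Cfg 23 m w) = Cfg 24 (m(5 := m 2 - m (Suc 0))) w"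
  "step ed_prog x (Cfg 24 m w) = Cfg 25 (m(4 := m 4 - m 5)) w"
  "step ed_prog x (Cfg 37 m w) = Cfg 38 (m(3 := 0)) w"
  "step ed_prog x (Cfg 38 m w) = Cfg (if m 3 < m 2 then 40 else 39) m w"
  "step ed_prog x (Cfg 39 m w) = Cfg 63 m w"
  "step ed_prog x (Cfg 40 m w) = Cfg 41 m (w @ [m 10])"
  "step ed_prog x (Cfg 41 m w) = Cfg 42 (m(3 := m 3 + m 0)) w"
  "step ed_prog x (Cfg 42 m w) = Cfg 38 m w"
  "step ed_prog x (Cfg 43 m w) = Cfg 44 (m(3 := 0)) w"
  "step ed_prog x (Cfg 44 m w) = Cfg 45 (m(4 := m 2)) w"
  "step ed_prog x (Cfg 57 m w) = Cfg 58 m (w @ [m 10])"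
  "step ed_prog x (Cfg 58 m w) = Cfg 60 m w"
  "step ed_prog x (Cfg 59 m w) = Cfg 60 m (w @ [m 0])"
  "step ed_prog x (Cfg 60 m w) = Cfg 61 (m(3 := m 3 + m 0)) w"
  "step ed_prog x (Cfg 61 m w) = Cfg 62 (m(4 := m 4 + m 0)) w"
  "step ed_prog x (Cfg 62 m w) = Cfg (if m 3 < m 2 then 45 else 63) m w"
  by (simp_all add: step_def halted_def length_SP)
    (simp_all add: ed_prog_def scan_code_def assign_def)

section \<open>Running times of the two output loops\<close>

lemma scan_time_le: "scan_time x b h \<le> 6 * h\<^sup>2 + 3"
proof -
  have "(\<Sum>l<h. if distinct (take l (drop b x)) then 6 * (l + 1) else 0) \<le> (\<Sum>l<h. 6 * h)"
    by (rule sum_mono) auto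
  then show ?thesis
    by (simp add: scan_time_def power2_eq_square)
qed

lemma zero_loop:
  assumes "m 0 = 1" "m 2 = n" "m 3 = i" "m 10 = 0" "i \<le> n"
  shows "\<exists>m'. reach ed_prog x (4 * (n - i) + 2) (Cfg 38 m w) (Cfg 63 m' (w @ replicate (n - i) 0))"
  using assms
proof (induction "n - i" arbitrary: i m w)
  case 0
  have "reach ed_prog x (Suc (Suc 0)) (Cfg 38 m w) (Cfg 63 m w)"
    using 0 by (intro reach_step) (simp add: ed_prog_steps reach_refl)
  then show ?case
    using 0 by (intro exI[of _ m]) (simp add: numeral_2_eq_2)
next
  case (Suc r)
  let ?m = "m(3 := Suc i)"
  have "i < n"
    using Suc.hyps(2) by simp
  then have 1: "reach ed_prog x (Suc (Suc (Suc (Suc 0)))) (Cfg 38 m w) (Cfg 38 ?m (w @ [0]))"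
    using Suc.prems by (intro reach_step) (simp add: ed_prog_steps reach_refl)
  obtain m' where m': "reach ed_prog x (4 * (n - Suc i) + 2) (Cfg 38 ?m (w @ [0]))
      (Cfg 63 m' ((w @ [0]) @ replicate (n - Suc i) 0))"
  proof -
    have "r = n - Suc i" "?m 0 = 1" "?m 2 = n" "?m 3 = Suc i" "?m 10 = 0" "Suc i \<le> n"
      using Suc.prems Suc.hyps(2) by simp_all
    then show ?thesis
      using Suc.hyps(1)[of "Suc i" ?m "w @ [0]"] that by blast
  qed
  have n: "n - i = Suc (n - Suc i)"
    using Suc.hyps(2) by simp
  have "reach ed_prog x (4 * (n - i) + 2) (Cfg 38 m w)
      (Cfg 63 m' ((w @ [0]) @ replicate (n - Suc i) 0))"
    by (rule reach_mono[OF reach_trans[OF 1 m']]) (simp add: n)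
  then show ?case
    by (auto simp: n)
qed

text \<open>Registers 3 and 4 delimit the current window. Its scan takes at most
  \<open>6 * n\<^sup>2 + 3\<close> steps, writing and advancing at most 5. The loop test comes last,
  hence \<open>i < n\<close>.\<close>

lemma window_loop:
  assumes "m 0 = 1" "m 2 = n" "m 3 = i" "m 4 = i + n" "m 10 = 0" "i < n"
    and "length x = 2 * n - 1"
  shows "\<exists>m'. reach ed_prog x ((n - i) * (6 * n\<^sup>2 + 8)) (Cfg 45 m w)
    (Cfg 63 m' (w @ map (\<lambda>i. ED (take n (drop i x))) [i..<n]))"
  using assms
proof (induction "n - i" arbitrary: i m w)
  case 0
  then show ?case by simp
next
  case (Suc r)
  let ?D = "distinct (take n (drop i x))"
  let ?w = "w @ [ED (take n (drop i x))]"
  obtain m1 where m1: "frame m m1"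
    "reach ed_prog x (scan_time x i n) (Cfg 45 m w) (Cfg (if ?D then 59 else 57) m1 w)"
  proof -
    have "i + n \<le> length x"
      using Suc.prems by linarith
    then show ?thesis
      using scan_reach[OF ed_prog_code_at(3), of m i n x w] Suc.prems(1,3,4) that by blast
  qed
  let ?m = "m1(3 := Suc i, 4 := Suc (i + n))"
  have m1_eq: "m1 0 = 1" "m1 2 = n" "m1 3 = i" "m1 4 = i + n" "m1 10 = 0"
    using m1(1) Suc.prems by (simp_all add: frame_def)
  have "reach ed_prog x (Suc (Suc (Suc (Suc (Suc 0))))) (Cfg (if ?D then 59 else 57) m1 w)
      (Cfg (if Suc i < n then 45 else 63) ?m ?w)"
  proof (cases ?D)
    case True
    have "reach ed_prog x (Suc (Suc (Suc (Suc 0)))) (Cfg 59 m1 w)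
        (Cfg (if Suc i < n then 45 else 63) ?m ?w)"
      using m1_eq True by (intro reach_step) (simp add: ed_prog_steps reach_refl ED_def)
    then show ?thesis
      using True by (auto intro: reach_mono)
  next
    case False
    then have "ED (take n (drop i x)) = 0"
      by (simp add: ED_def)
    then show ?thesis
      using m1_eq False by (intro reach_step) (simp add: ed_prog_steps reach_refl)
  qed
  from reach_trans[OF m1(2) this]
  have iter: "reach ed_prog x (6 * n\<^sup>2 + 8) (Cfg 45 m w) (Cfg (if Suc i < n then 45 else 63) ?m ?w)"
    by (rule reach_mono) (use scan_time_le[of x i n] in simp)
  have up: "[i..<n] = i # [Suc i..<n]"
    using Suc.prems by (simp add: upt_rec)
  show ?case
  proof (cases "Suc i < n")
    case True
    obtain m' where m': "reach ed_prog x ((n - Suc i) * (6 * n\<^sup>2 + 8)) (Cfg 45 ?m ?w)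
        (Cfg 63 m' (?w @ map (\<lambda>i. ED (take n (drop i x))) [Suc i..<n]))"
    proof -
      have "r = n - Suc i" "?m 0 = 1" "?m 2 = n" "?m 3 = Suc i" "?m 4 = Suc i + n" "?m 10 = 0"
        using m1_eq Suc.hyps(2) by simp_all
      then show ?thesis
        using Suc.hyps(1)[of "Suc i" ?m ?w] True Suc.prems(7) that by blast
    qed
    have n: "n - i = Suc (n - Suc i)"
      using True by simp
    have "reach ed_prog x ((n - i) * (6 * n\<^sup>2 + 8)) (Cfg 45 m w)
        (Cfg 63 m' (?w @ map (\<lambda>i. ED (take n (drop i x))) [Suc i..<n]))"
      by (rule reach_mono[OF reach_trans[where k = "6 * n\<^sup>2 + 8", OF _ m']])
        (use iter True n in simp_all)
    then show ?thesis
      by (auto simp: up)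
  next
    case False
    then have "n - i = 1" "[Suc i..<n] = []"
      using Suc.prems by simp_all
    then show ?thesis
      using iter False up by auto
  qed
qed

text \<open>The 16 consists of 9 and 4 instructions before the two scans, 1 before the zero loop and
  2 to leave it. Both scans and the zero loop are charged on every path; only the fallback is
  conditional.\<close>

definition time_bound :: "nat \<Rightarrow> nat list \<Rightarrow> nat" where
  "time_bound n x =
    16 + 4 * n + scan_time x (n - 1 - n div 2) (n div 2) + scan_time x (n - 1) (n div 2) +
    (if distinct (take (n div 2) (drop (n - 1 - n div 2) x)) \<or>
        distinct (take (n div 2) (drop (n - 1) x))
     then 2 + n * (6 * n\<^sup>2 + 8) else 0)"

text \<open>The block is a factor of the window, and distinctness passes to factors.\<close>

lemma not_distinct_window:
  assumes "\<not> distinct (take h (drop b x))" "i \<le> b" "b + h \<le> i + n"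
  shows "\<not> distinct (take n (drop i x))"
proof
  assume "distinct (take n (drop i x))"
  then have "distinct (take h (drop (b - i) (take n (drop i x))))"
    using distinct_drop distinct_take by blast
  moreover have "take h (drop (b - i) (take n (drop i x))) = take h (drop b x)"
    using assms(2,3) by (simp add: drop_take min_def)
  ultimately show False
    using assms(1) by simp
qed

text \<open>Let \<open>h = n div 2\<close>. A window starting at or before \<open>n - 1 - h\<close>
  contains the first block. Any other starts at \<open>n - h\<close> or later and ends at
  \<open>2 * n - h\<close> or later, which is past the second block because \<open>2 * h\<close> is
  at most \<open>n\<close>.\<close>

lemma sliding_ED_zero:
  assumes "\<not> distinct (take (n div 2) (drop (n - 1 - n div 2) x))"
    and "\<not> distinct (take (n div 2) (drop (n - 1) x))"
  shows "sliding ED n x = replicate n 0"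
proof -
  have "ED (take n (drop i x)) = 0" if "i < n" for i
  proof (cases "i \<le> n - 1 - n div 2")
    case True
    have "\<not> distinct (take n (drop i x))"
      by (rule not_distinct_window[OF assms(1) True]) (use that in auto)
    then show ?thesis by (simp add: ED_def)
  next
    case False
    have "\<not> distinct (take n (drop i x))"
      by (rule not_distinct_window[OF assms(2)]) (use that False in auto)
    then show ?thesis by (simp add: ED_def)
  qed
  then have "sliding ED n x = map (\<lambda>i. 0) [0..<n]"
    unfolding sliding_def by (intro map_cong) auto
  then show ?thesis
    by (simp add: map_replicate_const)
qed

section \<open>Paths through the whole program\<close>

lemma ed_prog_brute_force:
  assumes "m 0 = 1" "m 2 = n" "m 10 = 0" "n \<ge> 1" "length x = 2 * n - 1"
  shows "\<exists>m'. reach ed_prog x (2 + n * (6 * n\<^sup>2 + 8)) (Cfg 43 m []) (Cfg 63 m' (sliding ED n x))"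
proof -
  let ?m = "m(3 := 0, 4 := n)"
  have 1: "reach ed_prog x (Suc (Suc 0)) (Cfg 43 m []) (Cfg 45 ?m [])"
    using assms by (intro reach_step) (simp add: ed_prog_steps reach_refl)
  obtain m' where "reach ed_prog x ((n - 0) * (6 * n\<^sup>2 + 8)) (Cfg 45 ?m [])
      (Cfg 63 m' ([] @ map (\<lambda>i. ED (take n (drop i x))) [0..<n]))"
    using window_loop[of ?m n 0 x "[]"] assms by auto
  from reach_trans[OF 1 this] show ?thesis
    by (auto simp: sliding_def)
qed

text \<open>There are three paths: the fallback after the first scan, the fallback after the second,
  and the zero loop. For \<open>n = 1\<close> both blocks are empty, hence distinct, and the
  fallback is taken.\<close>

lemma ed_prog_reach:
  assumes "n \<ge> 1" "length x = 2 * n - 1"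
  shows "\<exists>m'. reach ed_prog x (time_bound n x) init_config (Cfg 63 m' (sliding ED n x))"
proof -
  define h where "h = n div 2"
  let ?A = "distinct (take h (drop (n - 1 - h) x))"
  let ?B = "distinct (take h (drop (n - 1) x))"
  let ?F = "2 + n * (6 * n\<^sup>2 + 8)"
  \<comment> \<open>The third equation is the right end of the second block as the machine computes
    it, by subtracting from the input length.\<close>
  have h: "n - 1 - h + h = n - 1" "n - 1 + h \<le> length x" "2 * n - 1 - (n - h) = n - 1 + h"
    using assms unfolding h_def by auto
  have bound: "time_bound n x = 16 + 4 * n + scan_time x (n - 1 - h) h + scan_time x (n - 1) h +
      (if ?A \<or> ?B then ?F else 0)"
    by (simp add: time_bound_def h_def)
  let ?m = "(\<lambda>_. 0)(0 := Suc 0, 2 := 2 * n - 1, 2 := 2 * n, Suc 0 := 2, 2 := n, Suc 0 := h,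
    9 := n - 1, 3 := n - 1 - h, 4 := n - 1)"
  \<comment> \<open>The machine recovers \<open>n\<close> from the length \<open>2 * n - 1\<close>
    by adding 1 and halving.\<close>
  have "Suc (2 * n - 1) = 2 * n"
    using assms by simp
  then have 1: "reach ed_prog x (Suc (Suc (Suc (Suc (Suc (Suc (Suc (Suc (Suc 0))))))))) init_config
      (Cfg 9 ?m [])"
    using assms by (intro reach_step) (simp add: init_config_def ed_prog_steps reach_refl h_def)
  obtain m1 where m1: "frame ?m m1"
    "reach ed_prog x (scan_time x (n - 1 - h) h) (Cfg 9 ?m []) (Cfg (if ?A then 43 else 21) m1 [])"
    using scan_reach[OF ed_prog_code_at(1), of ?m "n - 1 - h" h x "[]"] h by auto
  note 2 = reach_trans[OF 1 m1(2)]
  have m1_eq: "m1 0 = 1" "m1 (Suc 0) = h" "m1 2 = n" "m1 9 = n - 1" "m1 10 = 0"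
    using m1(1) by (simp_all add: frame_def)
  show ?thesis
  proof (cases ?A)
    case True
    obtain m' where "reach ed_prog x ?F (Cfg 43 m1 []) (Cfg 63 m' (sliding ED n x))"
      using ed_prog_brute_force[of m1 n x] m1_eq assms by auto
    then have "reach ed_prog x (time_bound n x) init_config (Cfg 63 m' (sliding ED n x))"
      by (intro reach_mono[OF reach_trans[OF 2]]) (use True bound in auto)
    then show ?thesis by blast
  next
    case A: False
    let ?m2 = "m1(3 := n - 1, 4 := 2 * n - 1, 5 := n - h, 4 := n - 1 + h)"
    have 3: "reach ed_prog x (Suc (Suc (Suc (Suc 0)))) (Cfg (if ?A then 43 else 21) m1 [])
        (Cfg 25 ?m2 [])"
      using assms A m1_eq h(3) by (intro reach_step) (simp add: ed_prog_steps reach_refl)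
    obtain m3 where m3: "frame ?m2 m3"
      "reach ed_prog x (scan_time x (n - 1) h) (Cfg 25 ?m2 []) (Cfg (if ?B then 43 else 37) m3 [])"
      using scan_reach[OF ed_prog_code_at(2), of ?m2 "n - 1" h x "[]"] h m1_eq by auto
    note 4 = reach_trans[OF reach_trans[OF 2 3] m3(2)]
    have m3_eq: "m3 0 = 1" "m3 2 = n" "m3 10 = 0"
      using m3(1) m1_eq by (simp_all add: frame_def)
    show ?thesis
    proof (cases ?B)
      case True
      obtain m' where "reach ed_prog x ?F (Cfg 43 m3 []) (Cfg 63 m' (sliding ED n x))"
        using ed_prog_brute_force[of m3 n x] m3_eq assms by auto
      then have "reach ed_prog x (time_bound n x) init_config (Cfg 63 m' (sliding ED n x))"
        by (intro reach_mono[OF reach_trans[OF 4]]) (use True bound in auto)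
      then show ?thesis by blast
    next
      case False
      have 5: "reach ed_prog x (Suc 0) (Cfg (if ?B then 43 else 37) m3 []) (Cfg 38 (m3(3 := 0)) [])"
        using False by (intro reach_step) (simp add: ed_prog_steps reach_refl)
      have "sliding ED n x = replicate n 0"
        using sliding_ED_zero[of n x] A False by (simp add: h_def)
      then obtain m' where "reach ed_prog x (4 * n + 2) (Cfg 38 (m3(3 := 0)) [])
          (Cfg 63 m' (sliding ED n x))"
        using zero_loop[of "m3(3 := 0)" n 0 x "[]"] m3_eq by auto
      then have "reach ed_prog x (time_bound n x) init_config (Cfg 63 m' (sliding ED n x))"
        by (rule reach_mono[OF reach_trans[OF reach_trans[OF 4 5]]]) (use A False bound in auto)
      then show ?thesis by blast
    qed
  qed
qed

lemma ed_prog_correct: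
  assumes "n \<ge> 1" "length x = 2 * n - 1"
  shows "ram_halts ed_prog x" "ram_output ed_prog x = sliding ED n x" "ram_time ed_prog x \<le> time_bound n x"
proof -
  obtain m' where "reach ed_prog x (time_bound n x) init_config (Cfg 63 m' (sliding ED n x))"
    using ed_prog_reach[OF assms] by blast
  from reach_halted[OF this]
  show "ram_halts ed_prog x" "ram_output ed_prog x = sliding ED n x" "ram_time ed_prog x \<le> time_bound n x"
    by (simp_all add: halted_def length_SP)
qed

subsection \<open>Probability that a random block is distinct\<close>

text \<open>The sample splits into independent samples of lengths \<open>b\<close>, \<open>l\<close>
  and the rest; the outer two are discarded.\<close>

lemma map_pmf_take_drop_replicate_pmf:
  assumes "b + l \<le> N"
  shows "map_pmf (\<lambda>x. take l (drop b x)) (replicate_pmf N p) = replicate_pmf l p"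
proof -
  have "map_pmf (\<lambda>x. take l (drop b x)) (replicate_pmf (b + (l + (N - (b + l)))) p) =
    do {xs \<leftarrow> replicate_pmf b p; ys \<leftarrow> replicate_pmf l p; zs \<leftarrow> replicate_pmf (N - (b + l)) p;
        return_pmf ys}"
    unfolding replicate_pmf_distrib map_pmf_def bind_assoc_pmf bind_return_pmf
    by (intro bind_pmf_cong refl) (auto simp: set_replicate_pmf)
  then show ?thesis
    using assms by (simp add: bind_return_pmf')
qed

text \<open>The birthday probability, called \<open>q l\<close> in the overview.\<close>

definition distinct_prob :: "nat \<Rightarrow> nat \<Rightarrow> real" where
  "distinct_prob n l = measure_pmf.prob (replicate_pmf l (pmf_of_set {1..n})) {xs. distinct xs}"

lemma distinct_prob_nonneg: "distinct_prob n l \<ge> 0"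
  by (simp add: distinct_prob_def)

lemma distinct_prob_le_1: "distinct_prob n l \<le> 1"
  by (simp add: distinct_prob_def)

lemma measure_pmf_eq_pmf_map: "measure_pmf.prob M {x. Q x} = pmf (map_pmf Q M) True"
  by (simp add: pmf_map vimage_def)

text \<open>Given \<open>l\<close> distinct letters, a fresh one avoids them with probability
  \<open>(n - l) / n\<close>.\<close>

lemma distinct_prob_Suc:
  assumes "n \<ge> 1" "l \<le> n"
  shows "distinct_prob n (Suc l) = (1 - real l / real n) * distinct_prob n l"
proof -
  let ?U = "pmf_of_set {1..n}"
  let ?R = "replicate_pmf l ?U"
  have cond: "measure_pmf.prob (map_pmf (\<lambda>u. u # xs) ?U) {xs. distinct xs} =
      (1 - real l / real n) * indicator {xs. distinct xs} xs" if "xs \<in> set_pmf ?R" for xs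
  proof (cases "distinct xs")
    case True
    have xs: "set xs \<subseteq> {1..n}" "length xs = l"
      using that assms by (auto simp: set_replicate_pmf)
    have "{1..n} \<inter> (\<lambda>u. u # xs) -` {xs. distinct xs} = {1..n} - set xs"
      using True by auto
    moreover have "card ({1..n} - set xs) = n - l"
      using xs True by (simp add: card_Diff_subset distinct_card)
    ultimately show ?thesis
      using assms True by (simp add: measure_pmf_of_set of_nat_diff field_simps)
  next
    case False
    then have "(\<lambda>u. u # xs) -` {xs. distinct xs} = {}"
      by auto
    with False show ?thesis by simp
  qed
  \<comment> \<open>The head is drawn first by definition; commuting the draws fixes the tail first,
    so that \<open>cond\<close> applies to the head.\<close>
  have "replicate_pmf (Suc l) ?U = bind_pmf ?R (\<lambda>xs. map_pmf (\<lambda>u. u # xs) ?U)"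
    unfolding replicate_pmf.simps map_pmf_def by (rule bind_commute_pmf)
  then have "distinct_prob n (Suc l) =
      measure_pmf.expectation ?R (\<lambda>xs. measure_pmf.prob (map_pmf (\<lambda>u. u # xs) ?U) {xs. distinct xs})"
    by (simp add: distinct_prob_def measure_pmf_eq_pmf_map map_bind_pmf pmf_bind)
  also have "\<dots> = measure_pmf.expectation ?R
      (\<lambda>xs. (1 - real l / real n) * indicator {xs. distinct xs} xs)"
    by (rule integral_cong_AE)
      (use cond in \<open>simp_all add: AE_measure_pmf_iff del: measure_map_pmf One_nat_def\<close>)
  also have "\<dots> = (1 - real l / real n) * distinct_prob n l"
    by (simp add: distinct_prob_def)
  finally show ?thesis .
qed

text \<open>The part with factor \<open>l\<close> telescopes to at most \<open>n\<close>; the part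
  with factor 1 has \<open>h\<close> terms, each at most 1.\<close>

lemma sum_distinct_prob_le:
  assumes "n \<ge> 1" "h \<le> n"
  shows "(\<Sum>l<h. real (l + 1) * distinct_prob n l) \<le> 2 * real n + 1"
proof -
  have *: "real l * distinct_prob n l = real n * (distinct_prob n l - distinct_prob n (Suc l))"
    if "l < h" for l
    using distinct_prob_Suc[of n l] that assms by (simp add: field_simps)
  have "(\<Sum>l<h. real l * distinct_prob n l) =
      real n * (\<Sum>l<h. distinct_prob n l - distinct_prob n (Suc l))"
    unfolding sum_distrib_left using * by (intro sum.cong) auto
  also have "\<dots> = real n * (distinct_prob n 0 - distinct_prob n h)"
    by (simp add: sum_lessThan_telescope')
  also have "\<dots> \<le> real n * 1"
    using distinct_prob_le_1[of n 0] distinct_prob_nonneg[of n h] by (intro mult_left_mono) auto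
  finally have 1: "(\<Sum>l<h. real l * distinct_prob n l) \<le> real n" by simp
  have "(\<Sum>l<h. distinct_prob n l) \<le> (\<Sum>l<h. 1)"
    by (intro sum_mono distinct_prob_le_1)
  then have "(\<Sum>l<h. distinct_prob n l) \<le> real n"
    using assms by simp
  then show ?thesis
    using 1 by (simp add: algebra_simps sum.distrib)
qed

text \<open>Once more than a quarter of the alphabet is used, each further letter contributes a
  factor of at most 3/4. From \<open>a\<close> letters on this happens \<open>n div 2 - a\<close>
  times, which is at least \<open>n / 4 - 2\<close>.\<close>

lemma distinct_prob_half_le:
  assumes "n \<ge> 1"
  shows "distinct_prob n (n div 2) \<le> (3 / 4) powr (real n / 4 - 2)"
proof -
  define a where "a = n div 4 + 1"
  have "distinct_prob n (a + d) \<le> (3 / 4) ^ d" if "a + d \<le> n" for d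
    using that
  proof (induction d)
    case 0
    then show ?case by (simp add: distinct_prob_le_1)
  next
    case (Suc d)
    have "real n / 4 \<le> real (a + d)"
      unfolding a_def by linarith
    then have "1 - real (a + d) / real n \<le> 3 / 4"
      using assms by (simp add: field_simps)
    moreover have "0 \<le> 1 - real (a + d) / real n"
      using Suc.prems assms by (simp add: field_simps)
    moreover have "distinct_prob n (a + d) \<le> (3 / 4) ^ d"
      using Suc by simp
    ultimately have "(1 - real (a + d) / real n) * distinct_prob n (a + d) \<le> 3 / 4 * (3 / 4) ^ d"
      by (intro mult_mono distinct_prob_nonneg) auto
    then show ?case
      using distinct_prob_Suc[of n "a + d"] Suc.prems assms by simp
  qed
  note bound = this
  show ?thesis
  proof (cases "a \<le> n div 2")
    case True
    have "distinct_prob n (n div 2) \<le> (3 / 4) ^ (n div 2 - a)"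
      using bound[of "n div 2 - a"] True by simp
    also have "\<dots> = (3 / 4) powr real (n div 2 - a)"
      by (simp add: powr_realpow)
    also have "\<dots> \<le> (3 / 4) powr (real n / 4 - 2)"
      using True unfolding a_def by (intro powr_mono') linarith+
    finally show ?thesis .
  next
    case False
    \<comment> \<open>For such small \<open>n\<close> the exponent is not positive and the bound is
      at least 1.\<close>
    have "real n / 4 - 2 \<le> 0"
      using False unfolding a_def by linarith
    then have "1 \<le> (3 / 4 :: real) powr (real n / 4 - 2)"
      using powr_mono'[of "real n / 4 - 2" 0 "3 / 4"] by simp
    then show ?thesis
      using distinct_prob_le_1[of n "n div 2"] by linarith
  qed
qed

section \<open>Random inputs and the expected time of a scan\<close>

lemma finite_set_input_distr: "n \<ge> 1 \<Longrightarrow> finite (set_pmf (input_distr n))"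
  unfolding input_distr_def set_replicate_pmf
  using finite_lists_length_eq[of "set_pmf (pmf_of_set {1..n})" "2 * n - 1"]
  by (simp add: lists_eq_set)

lemma prob_distinct_block:
  assumes "b + l \<le> 2 * n - 1"
  shows "measure_pmf.prob (input_distr n) {x. distinct (take l (drop b x))} = distinct_prob n l"
proof -
  have "distinct_prob n l = measure_pmf.prob
      (map_pmf (\<lambda>x. take l (drop b x)) (input_distr n)) {xs. distinct xs}"
    using map_pmf_take_drop_replicate_pmf[OF assms, of "pmf_of_set {1..n}"]
    by (simp only: distinct_prob_def input_distr_def)
  then show ?thesis
    by (simp add: vimage_def)
qed

text \<open>By linearity, each prefix contributes its distinctness probability, and
  \<open>6 * (2 * n + 1) + 3 = 12 * n + 9\<close>.\<close>

lemma expectation_scan_time_le: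
  assumes "n \<ge> 1" "b + h \<le> 2 * n - 1" "h \<le> n"
  shows "measure_pmf.expectation (input_distr n) (\<lambda>x. real (scan_time x b h)) \<le> 12 * real n + 9"
proof -
  let ?D = "input_distr n"
  \<comment> \<open>The support is finite, so every real function of the input is
    integrable.\<close>
  note int = integrable_measure_pmf_finite[OF finite_set_input_distr[OF assms(1)]]
  have "real (scan_time x b h) =
      (\<Sum>l<h. 6 * (real (l + 1) * indicator {x. distinct (take l (drop b x))} x)) + 3" for x
    by (auto simp: scan_time_def intro!: sum.cong)
  then have "measure_pmf.expectation ?D (\<lambda>x. real (scan_time x b h)) =
      measure_pmf.expectation ?D
        (\<lambda>x. (\<Sum>l<h. 6 * (real (l + 1) * indicator {x. distinct (take l (drop b x))} x)) + 3)"
    by simp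
  also have "\<dots> = (\<Sum>l<h. measure_pmf.expectation ?D
        (\<lambda>x. 6 * (real (l + 1) * indicator {x. distinct (take l (drop b x))} x))) + 3"
    by (subst Bochner_Integration.integral_add, (rule int)+)
      (subst Bochner_Integration.integral_sum, (rule int)+, simp)
  also have "\<dots> = (\<Sum>l<h. 6 * (real (l + 1) * distinct_prob n l)) + 3"
    using assms by (intro arg_cong2[where f = "(+)"] sum.cong refl) (simp add: prob_distinct_block)
  also have "\<dots> = 6 * (\<Sum>l<h. real (l + 1) * distinct_prob n l) + 3"
    by (simp add: sum_distrib_left)
  also have "\<dots> \<le> 12 * real n + 9"
    using sum_distinct_prob_le[OF assms(1,3)] by simp
  finally show ?thesis .
qed

subsection \<open>Space\<close>

text \<open>Register 0 never exceeds 1 and is the only allowed second summand, so a step raises the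
  largest content by at most 1. Contents are therefore bounded in terms of the running time alone,
  without any loop invariant.\<close>

fun tame :: "nat \<Rightarrow> nat \<Rightarrow> instr \<Rightarrow> bool" where
  "tame R L (Const r k) \<longleftrightarrow> r < R \<and> k \<le> (if r = 0 then 1 else 2)"
| "tame R L (Copy r i) \<longleftrightarrow> 0 < r \<and> r < R"
| "tame R L (Add r i j) \<longleftrightarrow> 0 < r \<and> r < R \<and> j = 0"
| "tame R L (Sub r i j) \<longleftrightarrow> 0 < r \<and> r < R"
| "tame R L (Div r i j) \<longleftrightarrow> 0 < r \<and> r < R"
| "tame R L (Length r) \<longleftrightarrow> 0 < r \<and> r < R"
| "tame R L (Read r i) \<longleftrightarrow> 0 < r \<and> r < R"
| "tame R L (Write i) \<longleftrightarrow> True"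
| "tame R L (Jump l) \<longleftrightarrow> l \<le> L"
| "tame R L (Jump_Eq i j l) \<longleftrightarrow> l \<le> L"
| "tame R L (Jump_Less i j l) \<longleftrightarrow> l \<le> L"
| "tame R L _ \<longleftrightarrow> False"

text \<open>Register 0 has a bound of its own because it is the increment that limits the growth of
  the other contents.\<close>

definition bounded_config :: "nat \<Rightarrow> nat \<Rightarrow> nat \<Rightarrow> config \<Rightarrow> bool" where
  "bounded_config R L N c \<longleftrightarrow>
    pc c \<le> L \<and> mem c 0 \<le> 1 \<and> (\<forall>a. mem c a \<le> N) \<and> (\<forall>a\<ge>R. mem c a = 0)"

lemma bounded_config_assign:
  assumes "bounded_config R L N c" "pc c < L" "r < R" "v \<le> Suc N" "r = 0 \<longrightarrow> v \<le> 1"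
  shows "bounded_config R L (Suc N) (assign r v c)"
  using assms by (auto simp: bounded_config_def assign_def le_Suc_eq)

text \<open>Only \<open>Add\<close> can exceed the old bound, by the content of register 0.
  Constants, the input length and letters are at most \<open>N\<close> by hypothesis; differences
  and quotients do not exceed their first operand.\<close>

lemma bounded_config_exec:
  assumes c: "bounded_config R L N c" "pc c < L" and "tame R L ins"
    and x: "length x \<le> N" "set x \<subseteq> {..N}" "2 \<le> N"
  shows "bounded_config R L (Suc N) (exec x ins c)"
proof -
  have b: "pc c \<le> L" "mem c 0 \<le> 1" "mem c a \<le> N" "a \<ge> R \<Longrightarrow> mem c a = 0" for a
    using c(1) by (auto simp: bounded_config_def)
  have nth: "x ! i \<le> N" if "i < length x" for i
    using x(2) that nth_mem by blast
  have sub: "mem c i - k \<le> Suc N" and dv: "mem c i div k \<le> Suc N" for i k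
    using b(3)[of i] div_le_dividend[of "mem c i" k] by linarith+
  \<comment> \<open>Serves the jumps and \<open>Write\<close>, which leave the memory
    unchanged.\<close>
  have cfg: "bounded_config R L (Suc N) c'"
    if "mem c' = mem c" "pc c' \<le> L" for c' :: config
    using that b by (auto simp: bounded_config_def le_SucI)
  show ?thesis
  proof (cases ins)
    case (Const r k)
    then show ?thesis
      using assms by (auto intro!: bounded_config_assign split: if_splits)
  next
    case (Add r i j)
    then show ?thesis
      using assms b(2) b(3)[of i] by (auto intro!: bounded_config_assign)
  qed (use assms sub dv b(3) in
      \<open>auto intro!: bounded_config_assign simp: cfg le_SucI nth\<close>)
qed

lemma bounded_config_run:
  assumes P: "\<forall>ins \<in> set P. tame R (length P) ins"
    and x: "length x \<le> N" "set x \<subseteq> {..N}" "2 \<le> N"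
  shows "bounded_config R (length P) (N + t) (run P x t)"
proof (induction t)
  case 0
  then show ?case
    by (simp add: run_def init_config_def bounded_config_def)
next
  case (Suc t)
  let ?c = "run P x t"
  have eq: "run P x (Suc t) = step P x ?c"
    by (simp add: run_def)
  show ?case
  proof (cases "halted P ?c")
    case True
    then show ?thesis
      using Suc by (auto simp: eq step_def bounded_config_def le_SucI)
  next
    case False
    then have "pc ?c < length P"
      by (simp add: halted_def)
    moreover have "set x \<subseteq> {..N + t}"
      using x(2) by auto
    ultimately show ?thesis
      using bounded_config_exec[OF Suc, of "P ! pc ?c" x] P x False
      by (simp add: eq step_def)
  qed
qed

lemma config_space_le:
  assumes "bounded_config R L N c"
  shows "config_space c \<le> floorlog 2 L + R * (floorlog 2 R + floorlog 2 N)"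
proof -
  have sub: "{a. mem c a \<noteq> 0} \<subseteq> {..<R}"
    using assms by (auto simp: bounded_config_def not_less[symmetric])
  have "(\<Sum>a \<in> {a. mem c a \<noteq> 0}. floorlog 2 a + floorlog 2 (mem c a)) \<le>
      (\<Sum>a<R. floorlog 2 a + floorlog 2 (mem c a))"
    by (rule sum_mono2) (use sub in auto)
  also have "\<dots> \<le> (\<Sum>a<R. floorlog 2 R + floorlog 2 N)"
    using assms by (intro sum_mono add_mono floorlog_mono) (auto simp: bounded_config_def)
  finally show ?thesis
    using assms floorlog_mono[of "pc c" L 2]
    by (simp add: config_space_def bounded_config_def)
qed

text \<open>With \<open>R\<close> and the program fixed, a polynomial bound \<open>M\<close> on the
  worst-case time already yields logarithmic space.\<close>

lemma ram_space_le:
  assumes "\<forall>ins \<in> set P. tame R (length P) ins"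
    and "length x \<le> N" "set x \<subseteq> {..N}" "2 \<le> N" "N + ram_time P x \<le> M"
  shows "ram_space P x \<le> floorlog 2 (length P) + R * (floorlog 2 R + floorlog 2 M)"
  unfolding ram_space_def
proof (rule Max.boundedI)
  fix s assume "s \<in> (\<lambda>t. config_space (run P x t)) ` {..ram_time P x}"
  then obtain t where t: "t \<le> ram_time P x" "s = config_space (run P x t)"
    by auto
  have "bounded_config R (length P) M (run P x t)"
    using bounded_config_run[OF assms(1-4), of t] t(1) assms(5)
    unfolding bounded_config_def by (meson add_left_mono order_trans)
  then show "s \<le> floorlog 2 (length P) + R * (floorlog 2 R + floorlog 2 M)"
    using config_space_le t(2) by simp
qed auto

subsection \<open>The bounds for the program\<close>

text \<open>Only registers 0 to 9 are written; register 10 is merely read, so it keeps its initial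
  0.\<close>

lemma ed_prog_tame: "\<forall>ins \<in> set ed_prog. tame 10 (length ed_prog) ins"
  unfolding length_SP by (simp add: ed_prog_def scan_code_def)

lemma fallback_time_le: "n \<ge> 1 \<Longrightarrow> 2 + n * (6 * n\<^sup>2 + 8) \<le> 16 * n ^ 3" for n :: nat
proof -
  assume n: "n \<ge> 1"
  have "n ^ 1 \<le> n ^ 3" "n ^ 0 \<le> n ^ 3"
    using n by (intro power_increasing; simp)+
  moreover have "n * (6 * n\<^sup>2 + 8) = 6 * n ^ 3 + 8 * n"
    by (simp add: algebra_simps power2_eq_square power3_eq_cube)
  ultimately show ?thesis
    by simp
qed

text \<open>The extra \<open>2 * n\<close> is the initial bound on contents in the space estimate.
  The coefficients add up to 56, rounded up to 64.\<close>

lemma time_bound_le: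
  assumes "n \<ge> 1"
  shows "2 * n + time_bound n x \<le> 64 * n ^ 3"
proof -
  have "n ^ 1 \<le> n ^ 3" "n ^ 0 \<le> n ^ 3" "n ^ 2 \<le> n ^ 3"
    using assms by (intro power_increasing; simp)+
  moreover have "scan_time x b (n div 2) \<le> 6 * n ^ 2 + 3" for b
    using scan_time_le[of x b "n div 2"] power_mono[of "n div 2" n 2] by linarith
  from this[of "n - 1 - n div 2"] this[of "n - 1"]
  have "time_bound n x \<le> 16 + 4 * n + 2 * (6 * n ^ 2 + 3) + (2 + n * (6 * n\<^sup>2 + 8))"
    unfolding time_bound_def by simp
  then have "time_bound n x \<le> 16 + 4 * n + 2 * (6 * n ^ 2 + 3) + 16 * n ^ 3"
    using add_left_mono[OF fallback_time_le[OF assms]] by (rule order_trans)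
  ultimately show ?thesis
    by simp
qed

lemma expectation_time_bound_le:
  assumes n: "n \<ge> 1"
  shows "measure_pmf.expectation (input_distr n) (\<lambda>x. real (time_bound n x)) \<le>
    34 + 28 * real n + 32 * real n ^ 3 * (3 / 4) powr (real n / 4 - 2)"
proof -
  define h where "h = n div 2"
  define F where "F = 2 + n * (6 * n\<^sup>2 + 8)"
  let ?E = "measure_pmf.expectation (input_distr n)"
  let ?A = "{x. distinct (take h (drop (n - 1 - h) x))}"
  let ?B = "{x. distinct (take h (drop (n - 1) x))}"
  let ?q = "(3 / 4) powr (real n / 4 - 2)"
  have int: "integrable (measure_pmf (input_distr n)) f" for f :: "nat list \<Rightarrow> real"
    by (rule integrable_measure_pmf_finite[OF finite_set_input_distr[OF n]])
  have h: "h \<le> n" "n - 1 - h + h \<le> 2 * n - 1" "n - 1 + h \<le> 2 * n - 1"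
    using n unfolding h_def by auto
  \<comment> \<open>Union bound: the indicator of the fallback is at most the sum of the indicators
    of the two blocks.\<close>
  have "?E (\<lambda>x. real (time_bound n x)) \<le>
      ?E (\<lambda>x. real (16 + 4 * n) + real (scan_time x (n - 1 - h) h) + real (scan_time x (n - 1) h) +
        (real F * indicator ?A x + real F * indicator ?B x))"
    by (rule integral_mono[OF int int]) (auto simp: time_bound_def h_def F_def)
  also have "\<dots> = real (16 + 4 * n) + ?E (\<lambda>x. real (scan_time x (n - 1 - h) h)) +
      ?E (\<lambda>x. real (scan_time x (n - 1) h)) +
      (real F * distinct_prob n h + real F * distinct_prob n h)"
    using h by (simp add: Bochner_Integration.integral_add[OF int int] prob_distinct_block)
  also have "\<dots> \<le> real (16 + 4 * n) + (12 * real n + 9) + (12 * real n + 9) +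
      (16 * real n ^ 3 * ?q + 16 * real n ^ 3 * ?q)"
  proof -
    have "real F \<le> real (16 * n ^ 3)"
      unfolding of_nat_le_iff F_def by (rule fallback_time_le[OF n])
    then have "real F * distinct_prob n h \<le> 16 * real n ^ 3 * ?q"
      using distinct_prob_half_le[OF n] distinct_prob_nonneg[of n h]
      by (intro mult_mono) (auto simp: h_def)
    then show ?thesis
      using expectation_scan_time_le[OF n h(2,1)] expectation_scan_time_le[OF n h(3,1)]
      by linarith
  qed
  finally show ?thesis
    by simp
qed

section \<open>Asymptotic bounds\<close>

lemma ed_prog_expected_time:
  "(\<lambda>n. measure_pmf.expectation (input_distr n) (\<lambda>x. real (ram_time ed_prog x))) \<in> O(\<lambda>n. real n)"
proof -
  let ?g = "\<lambda>n. 34 + 28 * real n + 32 * real n ^ 3 * (3 / 4) powr (real n / 4 - 2)"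
  have "measure_pmf.expectation (input_distr n) (\<lambda>x. real (ram_time ed_prog x)) \<le> ?g n"
    if n: "n \<ge> 1" for n
  proof -
    note int = integrable_measure_pmf_finite[OF finite_set_input_distr[OF n]]
    have "length x = 2 * n - 1" if "x \<in> set_pmf (input_distr n)" for x
      using that by (simp add: input_distr_def set_replicate_pmf)
    then have "measure_pmf.expectation (input_distr n) (\<lambda>x. real (ram_time ed_prog x)) \<le>
        measure_pmf.expectation (input_distr n) (\<lambda>x. real (time_bound n x))"
      using ed_prog_correct(3)[OF n] by (intro integral_mono_AE int) (auto simp: AE_measure_pmf_iff)
    also have "\<dots> \<le> ?g n"
      by (rule expectation_time_bound_le[OF n])
    finally show ?thesis .
  qed
  then have "(\<lambda>n. measure_pmf.expectation (input_distr n) (\<lambda>x. real (ram_time ed_prog x))) \<in> O(?g)"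
    by (intro bigoI[of _ 1] eventually_sequentiallyI[of 1]) auto
  \<comment> \<open>The exponential decay outweighs the cube, so the last term of \<open>?g\<close>
    tends to 0.\<close>
  also have "?g \<in> O(\<lambda>n. real n)"
    by real_asymp
  finally show ?thesis .
qed

text \<open>The number of binary digits is at most the logarithm plus 1, and the logarithm of a cube
  is three times that of the base.\<close>

lemma floorlog_cube_bigo:
  fixes a b c :: nat
  assumes "c \<ge> 1"
  shows "(\<lambda>n. real (a + b * floorlog 2 (c * n ^ 3))) \<in> O(\<lambda>n. log 2 (real n))"
proof -
  have "real (a + b * floorlog 2 (c * n ^ 3)) \<le>
      real a + real b * (log 2 (real c) + 3 * log 2 (real n) + 1)" if n: "n \<ge> 1" for n
  proof -
    have pos: "0 < c * n ^ 3"
      using assms n by simp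
    then have "0 \<le> log 2 (real (c * n ^ 3))"
      by (subst zero_le_log_cancel_iff) linarith+
    then have "real (floorlog 2 (c * n ^ 3)) \<le> log 2 (real (c * n ^ 3)) + 1"
      using pos by (simp add: floorlog_def del: of_nat_mult of_nat_power)
    also have "log 2 (real (c * n ^ 3)) = log 2 (real c) + 3 * log 2 (real n)"
      using assms n by (simp add: log_mult log_nat_power)
    finally show ?thesis
      by (simp add: mult_left_mono)
  qed
  then have "(\<lambda>n. real (a + b * floorlog 2 (c * n ^ 3))) \<in>
      O(\<lambda>n. real a + real b * (log 2 (real c) + 3 * log 2 (real n) + 1))"
    by (intro bigoI[of _ 1] eventually_sequentiallyI[of 1]) fastforce
  also have "(\<lambda>n. real a + real b * (log 2 (real c) + 3 * log 2 (real n) + 1)) \<in>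
      O(\<lambda>n. log 2 (real n))"
    by real_asymp
  finally show ?thesis .
qed

theorem theorem3p2:
  "\<exists>(P :: instr list) (s :: nat \<Rightarrow> nat).
     (\<forall>n\<ge>1. \<forall>x\<in>inputs n.
        ram_halts P x \<and> ram_output P x = sliding ED n x \<and> ram_space P x \<le> s n) \<and>
     (\<lambda>n. measure_pmf.expectation (input_distr n) (\<lambda>x. real (ram_time P x))) \<in> O(\<lambda>n. real n) \<and>
     (\<lambda>n. real (s n)) \<in> O(\<lambda>n. log 2 (real n))"
proof (intro exI conjI ballI allI impI)
  \<comment> \<open>There are 63 instructions, 10 registers, and contents of at most
    \<open>64 * n ^ 3\<close>.\<close>
  let ?s = "\<lambda>n. (floorlog 2 63 + 10 * floorlog 2 10) + 10 * floorlog 2 (64 * n ^ 3)"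
  fix n x assume n: "1 \<le> n" and x: "x \<in> inputs n"
  then have len: "length x = 2 * n - 1" and set: "set x \<subseteq> {1..n}"
    by (auto simp: inputs_def)
  show "ram_halts ed_prog x" "ram_output ed_prog x = sliding ED n x"
    using ed_prog_correct[OF n len] by auto
  have "2 * n + ram_time ed_prog x \<le> 64 * n ^ 3"
    using ed_prog_correct(3)[OF n len] time_bound_le[OF n, of x] by linarith
  moreover have "set x \<subseteq> {..2 * n}"
    using set by auto
  \<comment> \<open>The initial bound \<open>2 * n\<close> dominates the input length, the letters
    and the constant 2.\<close>
  ultimately show "ram_space ed_prog x \<le> ?s n"
    using ram_space_le[OF ed_prog_tame, of x "2 * n" "64 * n ^ 3"] len n
    unfolding length_SP by simp
next
  show "(\<lambda>n. measure_pmf.expectation (input_distr n) (\<lambda>x. real (ram_time ed_prog x))) \<in> O(\<lambda>n. real n)"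
    by (rule ed_prog_expected_time)
  show "(\<lambda>n. real ((floorlog 2 63 + 10 * floorlog 2 10) + 10 * floorlog 2 (64 * n ^ 3)))
      \<in> O(\<lambda>n. log 2 (real n))"
    by (rule floorlog_cube_bigo) simp
qed

end
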